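(* Let $\psi\in\mathcal{O}_M(\mathbb{R})$, $f\in\mathcal{O}'_M(\mathbb{R})$, and let $\mu_\alpha(f)=\langle f,x^\alpha\rangle$ ($\alpha=0,1,2,\dots$) be the moment sequence of $f$. For $a>0$, $b\in\mathbb{R}$ let $\psi_{a,b}(x)=\frac{1}{\sqrt a}\,\psi\big(\frac{x-b}{a}\big)$. Then for every fixed $b\in\mathbb{R}$, $$\langle f(x),\psi_{a,b}(x)\rangle\sim\sum_{\alpha=0}^{\infty}\frac{\mu_\alpha(f)\, D^\alpha\psi(-\frac{b}{a})}{\alpha!\,a^{\alpha+1/2}}\qquad\text{as } a\to\infty.$$
   Context: $\mathcal{O}_M(\mathbb{R})$ is the space of all $C^\infty$ functions on $\mathbb{R}$ all of whose derivatives are bounded by polynomials (of possibly different degrees for different derivatives), with its usual topology, given by the seminorms $\phi\mapsto\sup_{x\in\mathbb{R}}|\theta(x)D^\alpha\phi(x)|$ with $\theta$ in the Schwartz space and $\alpha\in\{0,1,2,\dots\}$; $\mathcal{O}'_M(\mathbb{R})$ is its dual. $D^\alpha$ is the $\alpha$-th derivative. $\langle\cdot,\cdot\rangle$ is the (bilinear) duality pairing in the variable $x$. The left-hand side is the continuous wavelet transform $(W_\psi f)(a,b)$ of $f$ with respect to $\psi$. The relation $\sim$ means asymptotic expansion with respect to the scale $a^{-\alpha-1/2}$: for every integer $N\ge 0$, the left-hand side minus the sum of the terms with $\alpha\le N$ is $o(a^{-N-1/2})$ as $a\to\infty$ (the coefficients $D^\alpha\psi(-b/a)$ may depend on $a$).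 *)

theory Defs
  imports "HOL-Analysis.Analysis" "HOL-Computational_Algebra.Polynomial"
    "HOL-Library.Landau_Symbols"
begin

definition Dn :: "nat \<Rightarrow> (real \<Rightarrow> complex) \<Rightarrow> real \<Rightarrow> complex" where
  "Dn n \<phi> = ((\<lambda>g x. vector_derivative g (at x)) ^^ n) \<phi>"

definition smooth :: "(real \<Rightarrow> complex) \<Rightarrow> bool" where
  "smooth \<phi> \<longleftrightarrow> (\<forall>n x. Dn n \<phi> differentiable (at x))"

definition Schwartz :: "(real \<Rightarrow> complex) set" where
  "Schwartz = {\<theta>. smooth \<theta> \<and>
     (\<forall>k n. bounded (range (\<lambda>x. complex_of_real (x ^ k) * Dn n \<theta> x)))}"

definition OM :: "(real \<Rightarrow> complex) set" where
  "OM = {\<phi>. smooth \<phi> \<and> (\<forall>n. \<exists>p :: real poly. \<forall>x. norm (Dn n \<phi> x) \<le> poly p x)}"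

(* The supremum is taken in the conditionally complete order of the reals; it is meaningful
   because the set is bounded whenever \<theta> is Schwartz and \<phi> lies in OM. *)
definition OM_seminorm ::
    "(real \<Rightarrow> complex) \<Rightarrow> nat \<Rightarrow> (real \<Rightarrow> complex) \<Rightarrow> real" where
  "OM_seminorm \<theta> \<alpha> \<phi> = (SUP x. norm (\<theta> x * Dn \<alpha> \<phi> x))"

(* The locally convex topology of the family of seminorms: the open seminorm balls, around all
   points of OM, form a subbase. Its underlying space is OM. *)
definition OM_topology :: "(real \<Rightarrow> complex) topology" where
  "OM_topology = topology_generated_by
     {{\<phi> \<in> OM. OM_seminorm \<theta> \<alpha> (\<lambda>x. \<phi> x - \<phi>\<^sub>0 x) < \<epsilon>} | \<theta> \<alpha> \<phi>\<^sub>0 \<epsilon>.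
        \<theta> \<in> Schwartz \<and> \<phi>\<^sub>0 \<in> OM \<and> \<epsilon> > 0}"

(* Functionals are total HOL functions of which only the values on OM matter; the duality
   pairing of f and \<phi> is the application f \<phi>. *)
definition OM_dual :: "((real \<Rightarrow> complex) \<Rightarrow> complex) set" where
  "OM_dual = {f.
     (\<forall>\<phi>\<in>OM. \<forall>\<eta>\<in>OM. f (\<lambda>x. \<phi> x + \<eta> x) = f \<phi> + f \<eta>) \<and>
     (\<forall>c. \<forall>\<phi>\<in>OM. f (\<lambda>x. c * \<phi> x) = c * f \<phi>) \<and>
     continuous_map OM_topology euclidean f}"

definition moment :: "((real \<Rightarrow> complex) \<Rightarrow> complex) \<Rightarrow> nat \<Rightarrow> complex" where
  "moment f \<alpha> = f (\<lambda>x. complex_of_real (x ^ \<alpha>))"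

definition wavelet :: "(real \<Rightarrow> complex) \<Rightarrow> real \<Rightarrow> real \<Rightarrow> real \<Rightarrow> complex" where
  "wavelet \<psi> a b = (\<lambda>x. complex_of_real (1 / sqrt a) * \<psi> ((x - b) / a))"

(* Bilinear pairing, so the wavelet is not conjugated. *)
definition wavelet_transform ::
    "(real \<Rightarrow> complex) \<Rightarrow> ((real \<Rightarrow> complex) \<Rightarrow> complex) \<Rightarrow> real \<Rightarrow> real \<Rightarrow> complex" where
  "wavelet_transform \<psi> f a b = f (wavelet \<psi> a b)"

(* Expansion of F at infinity into the terms t 0, t 1, ... with respect to the scale s: the terms
   are functions of the large variable, their coefficients along s need not be constant. *)
definition asymptotic_expansion ::
    "(real \<Rightarrow> complex) \<Rightarrow> (nat \<Rightarrow> real \<Rightarrow> complex) \<Rightarrow> (nat \<Rightarrow> real \<Rightarrow> real) \<Rightarrow> bool" where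
  "asymptotic_expansion F t s \<longleftrightarrow>
     (\<forall>N. (\<lambda>a. F a - (\<Sum>\<alpha>\<le>N. t \<alpha> a)) \<in> o[at_top](\<lambda>a. complex_of_real (s N a)))"

end

theory Submission
  imports Defs
begin

text \<open>
  Moving the moments to the other side of the expansion turns its error into one value of \<open>f\<close>.
  The Taylor polynomial at \<open>0\<close> of the wavelet \<open>x \<mapsto> \<psi> ((x - b) / a) / \<surd>a\<close> has the coefficients
  \<open>D\<^sup>\<alpha>\<psi> (- b / a) / (\<alpha>! a powr (\<alpha> + 1/2))\<close>, and \<open>f\<close> maps \<open>x\<^sup>\<alpha>\<close> to the moment of order \<open>\<alpha>\<close>. Thus
  the wavelet transform minus the first \<open>N + 1\<close> terms is \<open>f r\<^sub>a\<close>, where \<open>r\<^sub>a\<close> is the Taylor remainder of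
  order \<open>N\<close> of the wavelet (\<open>OM_dual_taylor_remainder\<close>). Since \<open>f\<close> is linear and continuous, it is
  enough that \<open>a powr (N + 1/2) \<cdot> r\<^sub>a\<close> tends to zero in the topology of the space
  (\<open>scaled_wavelet_remainder_tendsto_zero\<close>).

  For this it suffices that every derivative of the scaled remainder is at most \<open>1 / a\<close> times a polynomially
  growing function that does not depend on \<open>a\<close>; a Schwartz weight then absorbs the growth.
  A derivative of order \<open>n > N\<close> does not see the Taylor polynomial, and each differentiation of the
  wavelet contributes a factor \<open>1 / a\<close>, so the scaled derivative is
  \<open>a powr (N - n) \<cdot> D\<^sup>n\<psi> ((x - b) / a)\<close>; for \<open>a \<ge> 1\<close> the growth of \<open>D\<^sup>n\<psi>\<close> is evaluated at a point of
  modulus at most \<open>\<bar>b\<bar> + \<bar>x\<bar>\<close>. The derivatives of order at most \<open>N\<close> vanish at the origin, so the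
  estimate descends to them from order \<open>N + 1\<close> by the mean value inequality
  (\<open>growth_of_lower_derivatives\<close>).
\<close>

section \<open>Iterated derivatives\<close>

lemma Dn_0 [simp]: "Dn 0 \<phi> = \<phi>"
  by (simp add: Dn_def)

lemma Dn_Suc: "Dn (Suc n) \<phi> x = vector_derivative (Dn n \<phi>) (at x)"
  by (simp add: Dn_def)

lemma smooth_has_vector_derivative_Dn:
  assumes "smooth \<phi>"
  shows "(Dn n \<phi> has_vector_derivative Dn (Suc n) \<phi> x) (at x)"
  using assms vector_derivative_works unfolding smooth_def Dn_Suc by blast

text \<open>A formula for all derivatives at once is verified by a single differentiation, which yields
  smoothness too; this spares a separate induction for each of the operations below.\<close>

lemma derivative_sequence:
  assumes "\<And>n x. (F n has_vector_derivative F (Suc n) x) (at x)"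
  shows Dn_derivative_sequence: "Dn n (F 0) = F n"
    and smooth_derivative_sequence: "smooth (F 0)"
proof -
  have *: "Dn n (F 0) = F n" for n
  proof (induction n)
    case (Suc n)
    then show ?case
      using vector_derivative_at[OF assms] by (auto simp: Dn_Suc)
  qed simp
  show "Dn n (F 0) = F n" by (rule *)
  show "smooth (F 0)"
    unfolding smooth_def * using assms differentiableI_vector by blast
qed

lemma
  assumes "smooth \<phi>" "smooth \<eta>"
  shows Dn_add: "Dn n (\<lambda>x. \<phi> x + \<eta> x) = (\<lambda>x. Dn n \<phi> x + Dn n \<eta> x)"
    and smooth_add: "smooth (\<lambda>x. \<phi> x + \<eta> x)"
proof -
  let ?F = "\<lambda>n x. Dn n \<phi> x + Dn n \<eta> x"
  have "(?F n has_vector_derivative ?F (Suc n) x) (at x)" for n x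
    by (intro has_vector_derivative_add smooth_has_vector_derivative_Dn assms)
  from derivative_sequence[of ?F, OF this]
  show "Dn n (\<lambda>x. \<phi> x + \<eta> x) = ?F n" "smooth (\<lambda>x. \<phi> x + \<eta> x)" by simp_all
qed

lemma
  assumes "smooth \<phi>"
  shows Dn_mult_left: "Dn n (\<lambda>x. c * \<phi> x) = (\<lambda>x. c * Dn n \<phi> x)"
    and smooth_mult_left: "smooth (\<lambda>x. c * \<phi> x)"
proof -
  let ?F = "\<lambda>n x. c * Dn n \<phi> x"
  have "(?F n has_vector_derivative ?F (Suc n) x) (at x)" for n x
    by (intro has_vector_derivative_mult_right smooth_has_vector_derivative_Dn assms)
  from derivative_sequence[of ?F, OF this]
  show "Dn n (\<lambda>x. c * \<phi> x) = ?F n" "smooth (\<lambda>x. c * \<phi> x)" by simp_all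
qed

lemma
  fixes a b :: real
  assumes "smooth \<phi>"
  shows Dn_affine: "Dn n (\<lambda>x. \<phi> ((x - b) / a)) =
      (\<lambda>x. complex_of_real ((1 / a) ^ n) * Dn n \<phi> ((x - b) / a))"
    and smooth_affine: "smooth (\<lambda>x. \<phi> ((x - b) / a))"
proof -
  let ?F = "\<lambda>n x. complex_of_real ((1 / a) ^ n) * Dn n \<phi> ((x - b) / a)"
  have "(?F n has_vector_derivative ?F (Suc n) x) (at x)" for n x
  proof -
    have "((\<lambda>x. (x - b) / a) has_vector_derivative 1 / a) (at x)"
      unfolding has_real_derivative_iff_has_vector_derivative[symmetric]
      by (auto intro!: derivative_eq_intros simp: divide_inverse)
    from vector_diff_chain_at[OF this smooth_has_vector_derivative_Dn[OF assms, of n]]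
    have "((\<lambda>x. Dn n \<phi> ((x - b) / a)) has_vector_derivative
        (1 / a) *\<^sub>R Dn (Suc n) \<phi> ((x - b) / a)) (at x)"
      by (simp add: o_def)
    from has_vector_derivative_mult_right[OF this, of "complex_of_real ((1 / a) ^ n)"]
    show ?thesis by (simp add: scaleR_conv_of_real mult_ac)
  qed
  from derivative_sequence[of ?F, OF this]
  show "Dn n (\<lambda>x. \<phi> ((x - b) / a)) = ?F n" "smooth (\<lambda>x. \<phi> ((x - b) / a))" by simp_all
qed

text \<open>The binomial coefficient makes one formula valid in all orders: it vanishes for \<open>n > \<alpha>\<close>, where the
  truncated exponent \<open>\<alpha> - n\<close> would be wrong.\<close>

lemma
  shows Dn_monomial: "Dn n (\<lambda>x. complex_of_real (x ^ \<alpha>)) =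
      (\<lambda>x. complex_of_real (fact n * real (\<alpha> choose n) * x ^ (\<alpha> - n)))"
    and smooth_monomial: "smooth (\<lambda>x. complex_of_real (x ^ \<alpha>))"
proof -
  let ?F = "\<lambda>n x. complex_of_real (fact n * real (\<alpha> choose n) * x ^ (\<alpha> - n))"
  have "(?F n has_vector_derivative ?F (Suc n) x) (at x)" for n x
  proof -
    have "Suc n * (\<alpha> choose Suc n) = (\<alpha> - n) * (\<alpha> choose n)"
      by (metis binomial_absorb_comp binomial_absorption)
    then have coeff: "real (Suc n) * real (\<alpha> choose Suc n) = real (\<alpha> - n) * real (\<alpha> choose n)"
      by (metis of_nat_mult)
    have "((\<lambda>x. fact n * real (\<alpha> choose n) * x ^ (\<alpha> - n)) has_real_derivative
        fact n * real (\<alpha> choose n) * (real (\<alpha> - n) * x ^ (\<alpha> - Suc n))) (at x)"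
      by (auto intro!: derivative_eq_intros)
    also have "fact n * real (\<alpha> choose n) * (real (\<alpha> - n) * x ^ (\<alpha> - Suc n)) =
        fact n * (real (Suc n) * real (\<alpha> choose Suc n)) * x ^ (\<alpha> - Suc n)"
      unfolding coeff by (simp add: mult_ac)
    also have "\<dots> = fact (Suc n) * real (\<alpha> choose Suc n) * x ^ (\<alpha> - Suc n)"
      unfolding fact_Suc by (simp only: of_nat_mult mult_ac of_nat_fact)
    finally show ?thesis by (rule has_vector_derivative_of_real)
  qed
  from derivative_sequence[of ?F, OF this]
  show "Dn n (\<lambda>x. complex_of_real (x ^ \<alpha>)) = ?F n" "smooth (\<lambda>x. complex_of_real (x ^ \<alpha>))"
    by simp_all
qed

section \<open>The space of slowly growing smooth functions\<close>

lemma OM_smooth: "\<phi> \<in> OM \<Longrightarrow> smooth \<phi>"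
  by (simp add: OM_def)

lemma OM_I:
  assumes "smooth \<phi>" "\<And>n. \<exists>p :: real poly. \<forall>x. norm (Dn n \<phi> x) \<le> poly p x"
  shows "\<phi> \<in> OM"
  using assms by (simp add: OM_def)

lemma OM_poly_bound:
  assumes "\<phi> \<in> OM"
  obtains p :: "real poly" where "\<And>x. norm (Dn n \<phi> x) \<le> poly p x"
  using assms by (auto simp: OM_def)

lemma OM_add:
  assumes "\<phi> \<in> OM" "\<eta> \<in> OM"
  shows "(\<lambda>x. \<phi> x + \<eta> x) \<in> OM"
proof (rule OM_I)
  show "smooth (\<lambda>x. \<phi> x + \<eta> x)" by (intro smooth_add OM_smooth assms)
  fix n
  obtain p where p: "\<And>x. norm (Dn n \<phi> x) \<le> poly p x" using OM_poly_bound assms(1) by blast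
  obtain q where q: "\<And>x. norm (Dn n \<eta> x) \<le> poly q x" using OM_poly_bound assms(2) by blast
  have "norm (Dn n (\<lambda>x. \<phi> x + \<eta> x) x) \<le> poly (p + q) x" for x
    using norm_triangle_mono[OF p[of x] q[of x]]
    by (simp add: Dn_add OM_smooth assms)
  then show "\<exists>p. \<forall>x. norm (Dn n (\<lambda>x. \<phi> x + \<eta> x) x) \<le> poly p x" by blast
qed

lemma OM_mult_left:
  assumes "\<phi> \<in> OM"
  shows "(\<lambda>x. c * \<phi> x) \<in> OM"
proof (rule OM_I)
  show "smooth (\<lambda>x. c * \<phi> x)" by (intro smooth_mult_left OM_smooth assms)
  fix n
  obtain p where p: "\<And>x. norm (Dn n \<phi> x) \<le> poly p x" using OM_poly_bound assms by blast
  have "norm (Dn n (\<lambda>x. c * \<phi> x) x) \<le> poly (smult (norm c) p) x" for x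
    using mult_left_mono[OF p[of x], of "norm c"]
    by (simp add: Dn_mult_left OM_smooth assms norm_mult)
  then show "\<exists>p. \<forall>x. norm (Dn n (\<lambda>x. c * \<phi> x) x) \<le> poly p x" by blast
qed

lemma OM_affine:
  fixes a b :: real
  assumes "\<phi> \<in> OM"
  shows "(\<lambda>x. \<phi> ((x - b) / a)) \<in> OM"
proof (rule OM_I)
  show "smooth (\<lambda>x. \<phi> ((x - b) / a))" by (intro smooth_affine OM_smooth assms)
  fix n
  obtain p where p: "\<And>x. norm (Dn n \<phi> x) \<le> poly p x" using OM_poly_bound assms by blast
  define q where "q = smult \<bar>(1 / a) ^ n\<bar> (pcompose p [:- b / a, 1 / a:])"
  have "norm (Dn n (\<lambda>x. \<phi> ((x - b) / a)) x) \<le> poly q x" for x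
  proof -
    have "(x - b) / a = poly [:- b / a, 1 / a:] x" by (simp add: diff_divide_distrib)
    then have "poly q x = \<bar>(1 / a) ^ n\<bar> * poly p ((x - b) / a)"
      by (simp add: q_def poly_pcompose)
    then show ?thesis
      using mult_left_mono[OF p[of "(x - b) / a"], of "\<bar>(1 / a) ^ n\<bar>"]
      by (simp only: Dn_affine[OF OM_smooth[OF assms]] norm_mult norm_of_real)
  qed
  then show "\<exists>p. \<forall>x. norm (Dn n (\<lambda>x. \<phi> ((x - b) / a)) x) \<le> poly p x" by blast
qed

lemma OM_monomial: "(\<lambda>x. complex_of_real (x ^ \<alpha>)) \<in> OM"
proof (rule OM_I)
  show "smooth (\<lambda>x. complex_of_real (x ^ \<alpha>))" by (rule smooth_monomial)
  fix n
  define c where "c = fact n * real (\<alpha> choose n)"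
  define m where "m = \<alpha> - n"
  have "norm (Dn n (\<lambda>x. complex_of_real (x ^ \<alpha>)) x) \<le> poly (smult c (1 + monom 1 (2 * m))) x"
    for x
  proof -
    \<comment> \<open>For odd \<open>m\<close> the function \<open>\<bar>x\<bar> ^ m\<close> is not a polynomial, hence the detour over its square.\<close>
    have "\<bar>x\<bar> ^ m \<le> 1 + (\<bar>x\<bar> ^ m)\<^sup>2"
      using sum_squares_bound[of 1 "\<bar>x\<bar> ^ m"] zero_le_power[OF abs_ge_zero, of x m]
      unfolding power_one by linarith
    also have "(\<bar>x\<bar> ^ m)\<^sup>2 = x ^ (2 * m)"
      by (simp add: power_mult[symmetric] mult.commute power_even_abs)
    finally have "c * \<bar>x\<bar> ^ m \<le> c * (1 + x ^ (2 * m))"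
      by (rule mult_left_mono) (simp add: c_def)
    moreover have "norm (Dn n (\<lambda>x. complex_of_real (x ^ \<alpha>)) x) = \<bar>c * x ^ m\<bar>"
      unfolding Dn_monomial norm_of_real c_def m_def ..
    moreover have "\<bar>c * x ^ m\<bar> = c * \<bar>x\<bar> ^ m"
      by (simp add: c_def abs_mult power_abs)
    ultimately show ?thesis by (simp only: poly_smult poly_add poly_1 poly_monom mult_1)
  qed
  then show "\<exists>p. \<forall>x. norm (Dn n (\<lambda>x. complex_of_real (x ^ \<alpha>)) x) \<le> poly p x" by blast
qed

lemma OM_zero: "(\<lambda>x. 0) \<in> OM"
  using OM_mult_left[OF OM_monomial, of 0] by simp

lemma OM_sum:
  assumes "\<And>i. i \<in> A \<Longrightarrow> \<phi> i \<in> OM"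
  shows "(\<lambda>x. \<Sum>i\<in>A. \<phi> i x) \<in> OM"
  using assms by (induction A rule: infinite_finite_induct) (auto intro: OM_add OM_zero)

lemma OM_diff:
  assumes "\<phi> \<in> OM" "\<eta> \<in> OM"
  shows "(\<lambda>x. \<phi> x - \<eta> x) \<in> OM"
  using OM_add[OF assms(1) OM_mult_left[OF assms(2), of "-1"]] by simp

lemma Dn_diff:
  assumes "smooth \<phi>" "smooth \<eta>"
  shows "Dn n (\<lambda>x. \<phi> x - \<eta> x) = (\<lambda>x. Dn n \<phi> x - Dn n \<eta> x)"
  using Dn_add[OF assms(1) smooth_mult_left[OF assms(2), of "-1"], of n]
  by (simp only: Dn_mult_left[OF assms(2)]) simp

lemma Dn_zero: "Dn n (\<lambda>x. 0) = (\<lambda>x. 0)"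
  using Dn_mult_left[OF smooth_monomial, of n 0] by simp

lemma Dn_sum:
  assumes "\<And>i. i \<in> A \<Longrightarrow> \<phi> i \<in> OM"
  shows "Dn n (\<lambda>x. \<Sum>i\<in>A. \<phi> i x) = (\<lambda>x. \<Sum>i\<in>A. Dn n (\<phi> i) x)"
  using assms
proof (induction A rule: infinite_finite_induct)
  case (insert i A)
  have "smooth (\<phi> i)" "smooth (\<lambda>x. \<Sum>i\<in>A. \<phi> i x)"
    using insert.prems by (auto intro: OM_smooth OM_sum)
  with insert show ?case by (simp add: Dn_add)
qed (simp_all add: Dn_zero)

text \<open>Majorants of the form \<open>C (1 + B + \<bar>x\<bar>)\<^sup>m\<close> replace polynomials in the estimates: they increase
  with \<open>\<bar>x\<bar>\<close>, and a factor \<open>\<bar>x\<bar>\<close> only raises the exponent by one.\<close>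

lemma poly_growth:
  fixes p :: "real poly"
  obtains C m where "C \<ge> 0" "\<And>x. \<bar>poly p x\<bar> \<le> C * (1 + \<bar>x\<bar>) ^ m"
proof -
  have "\<exists>C m. C \<ge> 0 \<and> (\<forall>x. \<bar>poly p x\<bar> \<le> C * (1 + \<bar>x\<bar>) ^ m)"
  proof (induction p)
    case 0
    show ?case by (auto intro!: exI[of _ 0])
  next
    case (pCons c p)
    then obtain C m where C: "C \<ge> 0" and *: "\<And>x. \<bar>poly p x\<bar> \<le> C * (1 + \<bar>x\<bar>) ^ m" by blast
    have "\<bar>poly (pCons c p) x\<bar> \<le> (\<bar>c\<bar> + C) * (1 + \<bar>x\<bar>) ^ Suc m" for x
    proof -
      have "\<bar>poly (pCons c p) x\<bar> \<le> \<bar>c\<bar> + \<bar>x\<bar> * \<bar>poly p x\<bar>"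
        using abs_triangle_ineq[of c "x * poly p x"] by (simp add: abs_mult)
      also have "\<dots> \<le> \<bar>c\<bar> * (1 + \<bar>x\<bar>) ^ Suc m + (1 + \<bar>x\<bar>) * (C * (1 + \<bar>x\<bar>) ^ m)"
      proof (intro add_mono mult_mono *)
        show "\<bar>c\<bar> \<le> \<bar>c\<bar> * (1 + \<bar>x\<bar>) ^ Suc m"
          using mult_left_mono[OF one_le_power[of "1 + \<bar>x\<bar>" "Suc m"], of "\<bar>c\<bar>"] by simp
      qed auto
      finally show ?thesis by (simp add: algebra_simps)
    qed
    with C show ?case by (intro exI[of _ "\<bar>c\<bar> + C"] exI[of _ "Suc m"]) auto
  qed
  then show ?thesis using that by blast
qed

lemma OM_growth:
  assumes "\<phi> \<in> OM"
  obtains C m where "C \<ge> 0" "\<And>x. norm (Dn n \<phi> x) \<le> C * (1 + \<bar>x\<bar>) ^ m"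
proof -
  obtain p where p: "\<And>x. norm (Dn n \<phi> x) \<le> poly p x" using OM_poly_bound assms by blast
  obtain C m where C: "C \<ge> 0" "\<And>x. \<bar>poly p x\<bar> \<le> C * (1 + \<bar>x\<bar>) ^ m" using poly_growth by blast
  show ?thesis
  proof (rule that[OF C(1)])
    show "norm (Dn n \<phi> x) \<le> C * (1 + \<bar>x\<bar>) ^ m" for x
      using p[of x] C(2)[of x] by linarith
  qed
qed

text \<open>The majorant is at most \<open>(2 (1 + B))\<^sup>m\<close> for \<open>\<bar>x\<bar> \<le> 1 + B\<close> and at most \<open>(2 \<bar>x\<bar>)\<^sup>m\<close> elsewhere, so the
  decay of \<open>\<theta>\<close> against the two powers \<open>x\<^sup>0\<close> and \<open>x\<^sup>m\<close> suffices.\<close>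

lemma Schwartz_absorbs_growth:
  assumes "\<theta> \<in> Schwartz" "B \<ge> 0"
  obtains K where "K \<ge> 0" "\<And>x. norm (\<theta> x) * (1 + B + \<bar>x\<bar>) ^ m \<le> K"
proof -
  have "bounded (range (\<lambda>x. complex_of_real (x ^ k) * Dn 0 \<theta> x))" for k
    using assms(1) unfolding Schwartz_def by blast
  then have "\<exists>K. \<forall>x. norm (complex_of_real (x ^ k) * \<theta> x) \<le> K" for k
    by (force simp: bounded_iff)
  then obtain K where K: "\<And>k x. \<bar>x\<bar> ^ k * norm (\<theta> x) \<le> K k"
    by (metis norm_mult norm_of_real power_abs)
  have K_nonneg: "K k \<ge> 0" for k
    using order_trans[OF _ K[of 0 k]] by simp
  have "norm (\<theta> x) * (1 + B + \<bar>x\<bar>) ^ m \<le> (2 * (1 + B)) ^ m * K 0 + 2 ^ m * K m" for x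
  proof (cases "\<bar>x\<bar> \<le> 1 + B")
    case True
    have "norm (\<theta> x) * (1 + B + \<bar>x\<bar>) ^ m \<le> K 0 * (2 * (1 + B)) ^ m"
      using True assms(2) K[of x 0] K_nonneg by (intro mult_mono power_mono) auto
    moreover have "0 \<le> 2 ^ m * K m" using K_nonneg by simp
    ultimately show ?thesis by (simp add: mult.commute)
  next
    case False
    have "norm (\<theta> x) * (1 + B + \<bar>x\<bar>) ^ m \<le> norm (\<theta> x) * (2 * \<bar>x\<bar>) ^ m"
      using False assms(2) by (intro mult_left_mono power_mono) auto
    also have "\<dots> = 2 ^ m * (\<bar>x\<bar> ^ m * norm (\<theta> x))" by (simp add: power_mult_distrib)
    also have "\<dots> \<le> 2 ^ m * K m" using K by simp
    finally have "norm (\<theta> x) * (1 + B + \<bar>x\<bar>) ^ m \<le> 2 ^ m * K m" .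
    moreover have "0 \<le> (2 * (1 + B)) ^ m * K 0" using K_nonneg assms(2) by simp
    ultimately show ?thesis by linarith
  qed
  moreover have "(2 * (1 + B)) ^ m * K 0 + 2 ^ m * K m \<ge> 0" using K_nonneg assms(2) by simp
  ultimately show ?thesis using that by blast
qed

section \<open>Convergence to zero and continuous functionals\<close>

text \<open>A supremum of an unbounded set of reals is a junk value; boundedness makes the seminorm an upper
  bound of the weighted derivative.\<close>

lemma bdd_above_OM_seminorm:
  assumes "\<theta> \<in> Schwartz" "\<phi> \<in> OM"
  shows "bdd_above (range (\<lambda>x. norm (\<theta> x * Dn \<alpha> \<phi> x)))"
proof -
  obtain C m where C: "C \<ge> 0" "\<And>x. norm (Dn \<alpha> \<phi> x) \<le> C * (1 + \<bar>x\<bar>) ^ m"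
    using OM_growth assms(2) by blast
  obtain K where K: "\<And>x. norm (\<theta> x) * (1 + 0 + \<bar>x\<bar>) ^ m \<le> K"
    using Schwartz_absorbs_growth[OF assms(1) order_refl] by blast
  have "norm (\<theta> x * Dn \<alpha> \<phi> x) \<le> C * K" for x
  proof -
    have "norm (\<theta> x * Dn \<alpha> \<phi> x) \<le> norm (\<theta> x) * (C * (1 + \<bar>x\<bar>) ^ m)"
      unfolding norm_mult by (intro mult_left_mono C) simp
    also have "\<dots> = C * (norm (\<theta> x) * (1 + 0 + \<bar>x\<bar>) ^ m)" by simp
    also have "\<dots> \<le> C * K" by (intro mult_left_mono K C)
    finally show ?thesis .
  qed
  then show ?thesis by (auto simp: bdd_above_def)
qed

text \<open>Convergence has to be tested on subbasic sets only. These are seminorm balls with arbitrary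
  centres, hence the triangle inequality below.\<close>

lemma limitin_OM_zero:
  assumes mem: "\<forall>\<^sub>F a in F. R a \<in> OM"
    and small: "\<And>\<theta> \<alpha> \<epsilon>. \<theta> \<in> Schwartz \<Longrightarrow> \<epsilon> > 0 \<Longrightarrow>
      \<forall>\<^sub>F a in F. \<forall>x. norm (\<theta> x * Dn \<alpha> (R a) x) \<le> \<epsilon>"
  shows "limitin OM_topology R (\<lambda>x. 0) F"
proof -
  let ?S = "{{\<phi> \<in> OM. OM_seminorm \<theta> \<alpha> (\<lambda>x. \<phi> x - \<phi>\<^sub>0 x) < \<epsilon>} | \<theta> \<alpha> \<phi>\<^sub>0 \<epsilon>.
        \<theta> \<in> Schwartz \<and> \<phi>\<^sub>0 \<in> OM \<and> \<epsilon> > 0}"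
  have zero_Schwartz: "(\<lambda>x. 0) \<in> Schwartz"
    using OM_smooth[OF OM_zero] by (simp add: Schwartz_def Dn_zero)
  \<comment> \<open>The ball for the weight \<open>0\<close> is the whole space, so \<open>0\<close> is a point of the topology.\<close>
  have "{\<phi> \<in> OM. OM_seminorm (\<lambda>x. 0) 0 (\<lambda>x. \<phi> x - 0) < 1} \<in> ?S"
    using zero_Schwartz OM_zero by (intro CollectI exI conjI) (auto intro: zero_less_one)
  moreover have "(\<lambda>x. 0) \<in> {\<phi> \<in> OM. OM_seminorm (\<lambda>x. 0) 0 (\<lambda>x. \<phi> x - 0) < 1}"
    using OM_zero by (simp add: OM_seminorm_def)
  ultimately have top: "(\<lambda>x. 0) \<in> topspace OM_topology"
    unfolding OM_topology_def topology_generated_by_topspace by blast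
  have "\<forall>\<^sub>F a in F. R a \<in> U" if "generate_topology_on ?S U" "(\<lambda>x. 0) \<in> U" for U
    using that
  proof (induction rule: generate_topology_on.induct)
    case (Int A B)
    then show ?case by (auto intro: eventually_conj)
  next
    case (UN \<U>)
    then obtain A where A: "A \<in> \<U>" "(\<lambda>x. 0) \<in> A" by blast
    with UN have "\<forall>\<^sub>F a in F. R a \<in> A" by blast
    then show ?case by (rule eventually_mono) (use A in blast)
  next
    case (Basis s)
    then obtain \<theta> \<alpha> \<phi>\<^sub>0 \<epsilon> where s: "s = {\<phi> \<in> OM. OM_seminorm \<theta> \<alpha> (\<lambda>x. \<phi> x - \<phi>\<^sub>0 x) < \<epsilon>}"
      and \<theta>: "\<theta> \<in> Schwartz" and \<phi>\<^sub>0: "\<phi>\<^sub>0 \<in> OM" by blast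
    define r where "r = OM_seminorm \<theta> \<alpha> (\<lambda>x. 0 - \<phi>\<^sub>0 x)"
    have r: "r < \<epsilon>" using Basis.prems s r_def by simp
    have "\<forall>\<^sub>F a in F. \<forall>x. norm (\<theta> x * Dn \<alpha> (R a) x) \<le> (\<epsilon> - r) / 2"
      by (rule small[OF \<theta>]) (use r in simp)
    with mem show ?case
    proof eventually_elim
      case (elim a)
      have "OM_seminorm \<theta> \<alpha> (\<lambda>x. R a x - \<phi>\<^sub>0 x) \<le> (\<epsilon> - r) / 2 + r"
        unfolding OM_seminorm_def
      proof (rule cSUP_least)
        fix x
        have bound: "norm (\<theta> x * Dn \<alpha> (\<lambda>x. 0 - \<phi>\<^sub>0 x) x) \<le> r"
          unfolding r_def OM_seminorm_def
          by (intro cSUP_upper bdd_above_OM_seminorm \<theta> OM_diff OM_zero \<phi>\<^sub>0) simp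
        have "\<theta> x * Dn \<alpha> (\<lambda>x. R a x - \<phi>\<^sub>0 x) x =
            \<theta> x * Dn \<alpha> (R a) x + \<theta> x * Dn \<alpha> (\<lambda>x. 0 - \<phi>\<^sub>0 x) x"
          using elim(1) \<phi>\<^sub>0 OM_zero
          by (simp only: Dn_diff OM_smooth Dn_zero) (simp add: algebra_simps)
        then show "norm (\<theta> x * Dn \<alpha> (\<lambda>x. R a x - \<phi>\<^sub>0 x) x) \<le> (\<epsilon> - r) / 2 + r"
          using elim(2) bound by (metis norm_triangle_mono)
      qed simp
      also have "\<dots> < \<epsilon>" using r by (simp add: field_simps)
      finally show ?case using elim(1) s by simp
    qed
  qed simp
  then show ?thesis
    using top unfolding limitin_def OM_topology_def openin_topology_generated_by_iff by blast
qed

lemma OM_dual_add: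
  "f \<in> OM_dual \<Longrightarrow> \<phi> \<in> OM \<Longrightarrow> \<eta> \<in> OM \<Longrightarrow> f (\<lambda>x. \<phi> x + \<eta> x) = f \<phi> + f \<eta>"
  unfolding OM_dual_def by blast

lemma OM_dual_mult: "f \<in> OM_dual \<Longrightarrow> \<phi> \<in> OM \<Longrightarrow> f (\<lambda>x. c * \<phi> x) = c * f \<phi>"
  unfolding OM_dual_def by blast

lemma OM_dual_zero: "f \<in> OM_dual \<Longrightarrow> f (\<lambda>x. 0) = 0"
  using OM_dual_mult[OF _ OM_zero, of f 0] by simp

lemma OM_dual_diff:
  assumes "f \<in> OM_dual" "\<phi> \<in> OM" "\<eta> \<in> OM"
  shows "f (\<lambda>x. \<phi> x - \<eta> x) = f \<phi> - f \<eta>"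
  using OM_dual_add[OF assms(1,2) OM_mult_left[OF assms(3)], of "-1"]
  by (simp only: OM_dual_mult[OF assms(1,3)]) simp

lemma OM_dual_sum:
  assumes "f \<in> OM_dual" "\<And>i. i \<in> A \<Longrightarrow> \<phi> i \<in> OM"
  shows "f (\<lambda>x. \<Sum>i\<in>A. \<phi> i x) = (\<Sum>i\<in>A. f (\<phi> i))"
  using assms(2)
proof (induction A rule: infinite_finite_induct)
  case (insert i A)
  then show ?case by (simp add: OM_dual_add[OF assms(1)] OM_sum)
qed (simp_all add: OM_dual_zero[OF assms(1)])

lemma OM_dual_tendsto_zero:
  assumes "f \<in> OM_dual" "limitin OM_topology R (\<lambda>x. 0) F"
  shows "((\<lambda>a. f (R a)) \<longlongrightarrow> 0) F"
proof -
  have "continuous_map OM_topology euclidean f" using assms(1) by (simp add: OM_dual_def)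
  from continuous_map_limit[OF this assms(2)] show ?thesis
    by (simp add: o_def OM_dual_zero[OF assms(1)])
qed

section \<open>Taylor remainders at the origin\<close>

definition taylor_remainder :: "nat \<Rightarrow> (real \<Rightarrow> complex) \<Rightarrow> real \<Rightarrow> complex" where
  "taylor_remainder N \<phi> x =
     \<phi> x - (\<Sum>\<alpha>\<le>N. Dn \<alpha> \<phi> 0 / fact \<alpha> * complex_of_real (x ^ \<alpha>))"

lemma taylor_remainder_OM:
  assumes "\<phi> \<in> OM"
  shows "taylor_remainder N \<phi> \<in> OM"
  unfolding taylor_remainder_def[abs_def]
  by (intro OM_diff OM_sum OM_mult_left OM_monomial assms)

lemma OM_dual_taylor_remainder:
  assumes "f \<in> OM_dual" "\<phi> \<in> OM"
  shows "f (taylor_remainder N \<phi>) = f \<phi> - (\<Sum>\<alpha>\<le>N. Dn \<alpha> \<phi> 0 / fact \<alpha> * moment f \<alpha>)"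
  unfolding taylor_remainder_def[abs_def] moment_def
  by (simp only: OM_dual_diff[OF assms(1)] OM_dual_sum[OF assms(1)] OM_dual_mult[OF assms(1)]
      OM_sum OM_mult_left OM_monomial assms(2))

lemma Dn_taylor_remainder:
  assumes "\<phi> \<in> OM"
  shows "Dn n (taylor_remainder N \<phi>) x = Dn n \<phi> x -
    (\<Sum>\<alpha>\<le>N. Dn \<alpha> \<phi> 0 / fact \<alpha> * complex_of_real (fact n * real (\<alpha> choose n) * x ^ (\<alpha> - n)))"
  unfolding taylor_remainder_def[abs_def]
  by (simp only: Dn_diff Dn_sum OM_smooth OM_sum OM_mult_left OM_monomial assms Dn_mult_left
      Dn_monomial)

lemma Dn_taylor_remainder_high:
  assumes "\<phi> \<in> OM" "n > N"
  shows "Dn n (taylor_remainder N \<phi>) = Dn n \<phi>"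
  using assms(2) by (auto simp: Dn_taylor_remainder[OF assms(1)] binomial_eq_0 intro!: sum.neutral)

lemma Dn_taylor_remainder_at_0:
  assumes "\<phi> \<in> OM" "n \<le> N"
  shows "Dn n (taylor_remainder N \<phi>) 0 = 0"
proof -
  have "Dn \<alpha> \<phi> 0 / fact \<alpha> * complex_of_real (fact n * real (\<alpha> choose n) * 0 ^ (\<alpha> - n)) =
      (if \<alpha> = n then Dn n \<phi> 0 else 0)" for \<alpha>
    by (cases \<alpha> n rule: linorder_cases) (auto simp: binomial_eq_0)
  then show ?thesis
    using assms(2) by (simp add: Dn_taylor_remainder[OF assms(1)] sum.delta)
qed

text \<open>By the mean value inequality on the segment from the origin, where the lower derivatives vanish,
  each step down costs one factor \<open>\<bar>x\<bar>\<close>, which the majorant absorbs by raising its exponent by one.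
  So a bound on the top derivative alone controls all the lower ones with the same constant \<open>M\<close>;
  this constant is where the factor \<open>1 / a\<close> is carried.\<close>

lemma growth_of_lower_derivatives:
  assumes "smooth g" and zero: "\<And>k. k \<le> N \<Longrightarrow> Dn k g 0 = 0" and "M \<ge> 0" "B \<ge> 0"
    and top: "\<And>x. norm (Dn (Suc N) g x) \<le> M * (1 + B + \<bar>x\<bar>) ^ m"
    and "j \<le> Suc N"
  shows "norm (Dn (Suc N - j) g x) \<le> M * (1 + B + \<bar>x\<bar>) ^ (m + j)"
  using \<open>j \<le> Suc N\<close>
proof (induction j arbitrary: x)
  case 0
  then show ?case using top by simp
next
  case (Suc j)
  define k where "k = N - j"
  have k: "Suc N - Suc j = k" "Suc N - j = Suc k" "k \<le> N" using Suc.prems by (auto simp: k_def)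
  let ?Q = "M * (1 + B + \<bar>x\<bar>) ^ (m + j)"
  have "norm (Dn k g x - Dn k g 0) \<le> ?Q * norm (x - 0)"
  proof (rule differentiable_bound[where S = "closed_segment 0 x"
        and f' = "\<lambda>y h. h *\<^sub>R Dn (Suc k) g y"])
    fix y assume "y \<in> closed_segment 0 x"
    then have "\<bar>y\<bar> \<le> \<bar>x\<bar>" by (auto simp: closed_segment_eq_real_ivl split: if_splits)
    then have "M * (1 + B + \<bar>y\<bar>) ^ (m + j) \<le> ?Q"
      using assms(3,4) by (intro mult_left_mono power_mono) auto
    with Suc.IH[of y] Suc.prems have "norm (Dn (Suc k) g y) \<le> ?Q" by (simp add: k)
    then show "onorm (\<lambda>h. h *\<^sub>R Dn (Suc k) g y) \<le> ?Q"
      using assms(3,4) by (intro onorm_bound) (auto simp: mult.commute intro: mult_left_mono)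
    show "(Dn k g has_derivative (\<lambda>h. h *\<^sub>R Dn (Suc k) g y)) (at y within closed_segment 0 x)"
      using smooth_has_vector_derivative_Dn[OF assms(1)] has_vector_derivative_at_within
      unfolding has_vector_derivative_def[symmetric] by blast
  qed auto
  then have "norm (Dn k g x) \<le> ?Q * \<bar>x\<bar>" using zero[OF k(3)] by simp
  also have "\<dots> \<le> ?Q * (1 + B + \<bar>x\<bar>)" using assms(3,4) by (intro mult_left_mono) auto
  finally show ?case by (simp add: mult_ac flip: k_def)
qed

section \<open>The expansion of the wavelet transform\<close>

lemma wavelet_OM: "\<psi> \<in> OM \<Longrightarrow> wavelet \<psi> a b \<in> OM"
  unfolding wavelet_def by (intro OM_mult_left OM_affine)

lemma Dn_wavelet:
  assumes "\<psi> \<in> OM" "a > 0"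
  shows "Dn n (wavelet \<psi> a b) x =
    Dn n \<psi> ((x - b) / a) / complex_of_real (a powr (real n + 1 / 2))"
proof -
  have "Dn n (wavelet \<psi> a b) x =
      complex_of_real (1 / sqrt a) * (complex_of_real ((1 / a) ^ n) * Dn n \<psi> ((x - b) / a))"
    unfolding wavelet_def
    by (simp only: Dn_mult_left[OF smooth_affine] Dn_affine OM_smooth[OF assms(1)])
  moreover have "a powr (real n + 1 / 2) = a ^ n * sqrt a"
    using assms(2) by (simp add: powr_add powr_realpow powr_half_sqrt)
  ultimately show ?thesis by (simp add: power_divide field_simps)
qed

text \<open>The quotient of the scale by the factor from differentiation is \<open>a powr (N - n) \<le> 1 / a\<close>. The
  majorant is uniform in \<open>a\<close> because dilation by \<open>a \<ge> 1\<close> moves the argument of \<open>\<psi>\<close> towards \<open>0\<close>.\<close>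

lemma Dn_scaled_wavelet_growth:
  assumes "\<psi> \<in> OM" "n > N"
  obtains C m where "C \<ge> 0"
    "\<And>a x. a \<ge> 1 \<Longrightarrow> norm (complex_of_real (a powr (real N + 1 / 2)) * Dn n (wavelet \<psi> a b) x)
       \<le> C / a * (1 + \<bar>b\<bar> + \<bar>x\<bar>) ^ m"
proof -
  obtain C m where C: "C \<ge> 0" "\<And>x. norm (Dn n \<psi> x) \<le> C * (1 + \<bar>x\<bar>) ^ m"
    using OM_growth assms(1) by blast
  show ?thesis
  proof (rule that[OF C(1)])
    fix a x :: real assume a: "a \<ge> 1"
    have "\<bar>(x - b) / a\<bar> \<le> \<bar>x - b\<bar>"
      using a divide_left_mono[of 1 a "\<bar>x - b\<bar>"] by simp
    then have arg: "\<bar>(x - b) / a\<bar> \<le> \<bar>b\<bar> + \<bar>x\<bar>" by linarith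
    have "norm (Dn n \<psi> ((x - b) / a)) \<le> C * (1 + \<bar>(x - b) / a\<bar>) ^ m" by (rule C)
    also have "\<dots> \<le> C * (1 + \<bar>b\<bar> + \<bar>x\<bar>) ^ m"
      using arg C(1) by (intro mult_left_mono power_mono) auto
    finally have \<psi>: "norm (Dn n \<psi> ((x - b) / a)) \<le> C * (1 + \<bar>b\<bar> + \<bar>x\<bar>) ^ m" .
    have "a powr (real N + 1 / 2) / a powr (real n + 1 / 2) = a powr (real N - real n)"
      using a by (simp add: powr_diff[symmetric])
    also have "\<dots> \<le> a powr (-1)" using a assms(2) by (intro powr_mono) auto
    also have "\<dots> = 1 / a" using a by (simp add: powr_minus_divide)
    finally have quot: "a powr (real N + 1 / 2) / a powr (real n + 1 / 2) \<le> 1 / a" .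
    have "norm (complex_of_real (a powr (real N + 1 / 2)) * Dn n (wavelet \<psi> a b) x) =
        a powr (real N + 1 / 2) / a powr (real n + 1 / 2) * norm (Dn n \<psi> ((x - b) / a))"
      using a by (simp add: Dn_wavelet[OF assms(1)] norm_mult norm_divide)
    also have "\<dots> \<le> 1 / a * (C * (1 + \<bar>b\<bar> + \<bar>x\<bar>) ^ m)"
      using a by (intro mult_mono quot \<psi>) auto
    finally show "norm (complex_of_real (a powr (real N + 1 / 2)) * Dn n (wavelet \<psi> a b) x)
       \<le> C / a * (1 + \<bar>b\<bar> + \<bar>x\<bar>) ^ m" by simp
  qed
qed

lemma Dn_scaled_wavelet_remainder_growth:
  assumes "\<psi> \<in> OM"
  obtains C m where "C \<ge> 0"
    "\<And>a x. a \<ge> 1 \<Longrightarrow> norm (complex_of_real (a powr (real N + 1 / 2)) *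
         Dn n (taylor_remainder N (wavelet \<psi> a b)) x) \<le> C / a * (1 + \<bar>b\<bar> + \<bar>x\<bar>) ^ m"
proof (cases "n > N")
  case True
  from Dn_scaled_wavelet_growth[OF assms this, of b] that
  show ?thesis unfolding Dn_taylor_remainder_high[OF wavelet_OM[OF assms] True] by blast
next
  case False
  obtain C m where C: "C \<ge> 0" and top:
    "\<And>a x. a \<ge> 1 \<Longrightarrow> norm (complex_of_real (a powr (real N + 1 / 2)) *
        Dn (Suc N) (wavelet \<psi> a b) x) \<le> C / a * (1 + \<bar>b\<bar> + \<bar>x\<bar>) ^ m"
    using Dn_scaled_wavelet_growth[OF assms lessI, of N b] by blast
  show ?thesis
  proof (rule that[OF C])
    fix a x :: real assume a: "a \<ge> 1"
    let ?c = "complex_of_real (a powr (real N + 1 / 2))"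
    let ?r = "taylor_remainder N (wavelet \<psi> a b)"
    have r: "smooth ?r" by (intro OM_smooth taylor_remainder_OM wavelet_OM assms)
    have "norm (Dn (Suc N - (Suc N - n)) (\<lambda>x. ?c * ?r x) x)
        \<le> C / a * (1 + \<bar>b\<bar> + \<bar>x\<bar>) ^ (m + (Suc N - n))"
    proof (rule growth_of_lower_derivatives)
      show "smooth (\<lambda>x. ?c * ?r x)" by (rule smooth_mult_left[OF r])
      show "Dn k (\<lambda>x. ?c * ?r x) 0 = 0" if "k \<le> N" for k
        using Dn_taylor_remainder_at_0[OF wavelet_OM[OF assms] that]
        by (simp add: Dn_mult_left[OF r])
      show "norm (Dn (Suc N) (\<lambda>x. ?c * ?r x) x) \<le> C / a * (1 + \<bar>b\<bar> + \<bar>x\<bar>) ^ m" for x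
        unfolding Dn_mult_left[OF r] Dn_taylor_remainder_high[OF wavelet_OM[OF assms] lessI]
        by (rule top[OF a])
    qed (use a C in auto)
    then show "norm (?c * Dn n ?r x) \<le> C / a * (1 + \<bar>b\<bar> + \<bar>x\<bar>) ^ (m + (Suc N - n))"
      using False by (simp add: Dn_mult_left[OF r])
  qed
qed

lemma scaled_wavelet_remainder_tendsto_zero:
  assumes "\<psi> \<in> OM"
  shows "limitin OM_topology
    (\<lambda>a x. complex_of_real (a powr (real N + 1 / 2)) * taylor_remainder N (wavelet \<psi> a b) x)
    (\<lambda>x. 0) at_top"
proof (rule limitin_OM_zero)
  have OM: "taylor_remainder N (wavelet \<psi> a b) \<in> OM" for a
    by (intro taylor_remainder_OM wavelet_OM assms)
  show "\<forall>\<^sub>F a in at_top. (\<lambda>x. complex_of_real (a powr (real N + 1 / 2)) *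
      taylor_remainder N (wavelet \<psi> a b) x) \<in> OM"
    by (intro always_eventually allI OM_mult_left OM)
  fix \<theta> n and \<epsilon> :: real assume \<theta>: "\<theta> \<in> Schwartz" and \<epsilon>: "\<epsilon> > 0"
  obtain C m where C: "C \<ge> 0" and growth:
    "\<And>a x. a \<ge> 1 \<Longrightarrow> norm (complex_of_real (a powr (real N + 1 / 2)) *
         Dn n (taylor_remainder N (wavelet \<psi> a b)) x) \<le> C / a * (1 + \<bar>b\<bar> + \<bar>x\<bar>) ^ m"
    using Dn_scaled_wavelet_remainder_growth[OF assms] by blast
  obtain K where K: "\<And>x. norm (\<theta> x) * (1 + \<bar>b\<bar> + \<bar>x\<bar>) ^ m \<le> K"
    using Schwartz_absorbs_growth[OF \<theta> abs_ge_zero] by blast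
  show "\<forall>\<^sub>F a in at_top. \<forall>x. norm (\<theta> x * Dn n (\<lambda>x. complex_of_real (a powr (real N + 1 / 2)) *
      taylor_remainder N (wavelet \<psi> a b) x) x) \<le> \<epsilon>"
    using eventually_ge_at_top[of 1] eventually_ge_at_top[of "C * K / \<epsilon>"]
  proof eventually_elim
    case (elim a)
    show ?case
    proof
      fix x
      let ?D = "complex_of_real (a powr (real N + 1 / 2)) *
        Dn n (taylor_remainder N (wavelet \<psi> a b)) x"
      have "norm (\<theta> x * ?D) \<le> norm (\<theta> x) * (C / a * (1 + \<bar>b\<bar> + \<bar>x\<bar>) ^ m)"
        unfolding norm_mult[of "\<theta> x"] by (intro mult_left_mono growth elim) simp
      also have "\<dots> = C / a * (norm (\<theta> x) * (1 + \<bar>b\<bar> + \<bar>x\<bar>) ^ m)" by simp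
      also have "\<dots> \<le> C / a * K" using elim C by (intro mult_left_mono K) auto
      also have "\<dots> \<le> \<epsilon>" using elim \<epsilon> by (simp add: field_simps)
      finally show "norm (\<theta> x * Dn n (\<lambda>x. complex_of_real (a powr (real N + 1 / 2)) *
          taylor_remainder N (wavelet \<psi> a b) x) x) \<le> \<epsilon>"
        by (simp only: Dn_mult_left[OF OM_smooth[OF OM]])
    qed
  qed
qed

theorem theorem5p1:
  fixes \<psi> :: "real \<Rightarrow> complex" and f :: "(real \<Rightarrow> complex) \<Rightarrow> complex" and b :: real
  assumes "\<psi> \<in> OM" and "f \<in> OM_dual"
  shows "asymptotic_expansion
    (\<lambda>a. wavelet_transform \<psi> f a b)
    (\<lambda>\<alpha> a. moment f \<alpha> * Dn \<alpha> \<psi> (- b / a) /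
       complex_of_real (fact \<alpha> * a powr (real \<alpha> + 1 / 2)))
    (\<lambda>N a. a powr (- real N - 1 / 2))"
  unfolding asymptotic_expansion_def
proof
  fix N
  let ?r = "\<lambda>a. taylor_remainder N (wavelet \<psi> a b)"
  let ?E = "\<lambda>a. wavelet_transform \<psi> f a b - (\<Sum>\<alpha>\<le>N. moment f \<alpha> * Dn \<alpha> \<psi> (- b / a) /
       complex_of_real (fact \<alpha> * a powr (real \<alpha> + 1 / 2)))"
  have "((\<lambda>a. f (\<lambda>x. complex_of_real (a powr (real N + 1 / 2)) * ?r a x)) \<longlongrightarrow> 0) at_top"
    by (intro OM_dual_tendsto_zero scaled_wavelet_remainder_tendsto_zero assms)
  moreover have "\<forall>\<^sub>F a in at_top. f (\<lambda>x. complex_of_real (a powr (real N + 1 / 2)) * ?r a x) =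
      ?E a / complex_of_real (a powr (- real N - 1 / 2))"
    using eventually_gt_at_top[of 0]
  proof eventually_elim
    case (elim a)
    have scale: "complex_of_real (a powr (real N + 1 / 2)) =
        inverse (complex_of_real (a powr (- real N - 1 / 2)))"
      by (simp add: powr_minus[symmetric] add.commute flip: of_real_inverse)
    have "f (\<lambda>x. complex_of_real (a powr (real N + 1 / 2)) * ?r a x) =
        complex_of_real (a powr (real N + 1 / 2)) * f (?r a)"
      by (intro OM_dual_mult taylor_remainder_OM wavelet_OM assms)
    moreover have "f (?r a) = ?E a"
      using elim by (simp add: OM_dual_taylor_remainder wavelet_OM assms wavelet_transform_def
          Dn_wavelet mult_ac)
    ultimately show ?case
      by (simp only: scale divide_inverse_commute[of "?E a"])
  qed
  ultimately have "((\<lambda>a. ?E a / complex_of_real (a powr (- real N - 1 / 2))) \<longlongrightarrow> 0) at_top"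
    by (rule Lim_transform_eventually)
  then show "?E \<in> o[at_top](\<lambda>a. complex_of_real (a powr (- real N - 1 / 2)))"
    by (rule smalloI_tendsto)
      (auto intro: eventually_mono[OF eventually_gt_at_top[of 0]])
qed

end
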